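(* Let $(E,\mathrm{Bor}(E),\preceq)$ be a pogroup endowed with its Borel $\sigma$-algebra $\mathrm{Bor}(E)$. Let $X,Y$ be random variables on $E$ (defined on a common probability space), and assume the following: (1) the law $\mathbf{P}_X$ of $X$ is positively associated; (2) for almost every value of $X$, the conditional law $\mathbf{P}_Y(\cdot\,|\,X)$ of $Y$ given $X$ is positively associated; (3) for any $f:E\to\mathbb{R}$ bounded and increasing, the function $x\mapsto \mathbf{E}[f(X+Y)\,|\,X=x]$ is increasing $\mathbf{P}_X$-almost everywhere. Then the law $\mathbf{P}_{X+Y}$ of $X+Y$ is positively associated.
   Context: A partially ordered topological group (pogroup) is a pair $(E,\preceq)$ where $E$ is an abelian topological group (written additively) and $\preceq$ is a partial order on $E$ such that: for all $x,y,z\in E$, $x\preceq y$ implies $x+z\preceq y+z$; and the non-negative cone $\{x\in E: 0\preceq x\}$ is closed. Throughout, partial orders are assumed measurable, i.e. for $(E,\mathcal{E},\preceq)$ one has $\{(u,v)\in E^2: u\preceq v\}\in\mathcal{E}^{\otimes 2}$. A function $f:E\to\mathbb{R}$ is increasing if $u\preceq v$ implies $f(u)\leq f(v)$. A probability measure $\mathbf{P}$ on $(E,\mathcal{E},\preceq)$ is positively associated if, for $Z\sim\mathbf{P}$ and all increasing functions $f,g\in L^2(\mathbf{P})$, one has $\mathbf{E}[f(Z)g(Z)]\geq \mathbf{E}[f(Z)]\,\mathbf{E}[g(Z)]$.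
   Formalization: Addition on E is additionally assumed measurable from Bor(E)⊗Bor(E) to Bor(E) (automatic if E is second countable), so that sums of random variables are random variables; L²(P) is read with functions measurable for the completion of P. *)

theory Defs
  imports "HOL-Probability.Probability"
begin

class pogroup = topological_ab_group_add + ordered_ab_group_add +
  assumes closed_nonneg_cone: "closed {x. 0 \<le> x}"

(* Elements of L^2(P) are determined only up to P-null sets.  So "f belongs to L^2(P)" means
   that f agrees P-almost everywhere with a square-integrable measurable function, that is,
   f is measurable with respect to the completion of P and f^2 is integrable.  For a function
   that is measurable with respect to P itself the completion changes nothing. *)
definition in_L2 :: "'a measure \<Rightarrow> ('a \<Rightarrow> real) \<Rightarrow> bool" where
  "in_L2 P f \<longleftrightarrow>
     f \<in> borel_measurable (completion P) \<and> integrable (completion P) (\<lambda>z. (f z)\<^sup>2)"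

definition positively_associated :: "'a::order measure \<Rightarrow> bool" where
  "positively_associated P \<longleftrightarrow> prob_space P \<and>
     (\<forall>f g. mono f \<and> mono g \<and> in_L2 P f \<and> in_L2 P g \<longrightarrow>
        (\<integral>z. f z * g z \<partial>completion P)
          \<ge> (\<integral>z. f z \<partial>completion P) * (\<integral>z. g z \<partial>completion P))"

definition increasing_ae :: "'a::order measure \<Rightarrow> ('a \<Rightarrow> real) \<Rightarrow> bool" where
  "increasing_ae P h \<longleftrightarrow>
     (\<exists>N\<in>null_sets P. \<forall>u v. u \<notin> N \<longrightarrow> v \<notin> N \<longrightarrow> u \<le> v \<longrightarrow> h u \<le> h v)"

(* h is a version of x \<mapsto> E[Z | X = x]: it is measurable, and h(X) = E[Z | sigma(X)] almost
   surely.  The sigma-algebra sigma(X) is vimage_algebra (space M) X borel. *)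
definition cond_exp_given ::
  "'w measure \<Rightarrow> ('w \<Rightarrow> 'a::topological_space) \<Rightarrow> ('w \<Rightarrow> real) \<Rightarrow> ('a \<Rightarrow> real) \<Rightarrow> bool" where
  "cond_exp_given M X Z h \<longleftrightarrow> h \<in> borel_measurable borel \<and>
     (AE \<omega> in M. real_cond_exp M (vimage_algebra (space M) X borel) Z \<omega> = h (X \<omega>))"

(* K is a (regular) conditional law of Y given X: a Markov kernel such that, for every Borel
   set B, x \<mapsto> K x B is a version of x \<mapsto> P(Y \<in> B | X = x). *)
definition cond_law_given ::
  "'w measure \<Rightarrow> ('w \<Rightarrow> 'a::topological_space) \<Rightarrow> ('w \<Rightarrow> 'b::topological_space) \<Rightarrow>
     ('a \<Rightarrow> 'b measure) \<Rightarrow> bool" where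
  "cond_law_given M X Y K \<longleftrightarrow> K \<in> borel \<rightarrow>\<^sub>M prob_algebra borel \<and>
     (\<forall>B\<in>sets borel. cond_exp_given M X (\<lambda>\<omega>. indicator B (Y \<omega>)) (\<lambda>x. measure (K x) B))"

end

theory Submission
  imports Defs
begin

text \<open>
  The proof is a covariance decomposition. For bounded increasing \<open>f\<close> and \<open>g\<close> put
  \<open>F x = E[f (X + Y) | X = x]\<close> and \<open>G x = E[g (X + Y) | X = x]\<close>. For a fixed \<open>x\<close> the functions
  \<open>y \<mapsto> f (x + y)\<close> and \<open>y \<mapsto> g (x + y)\<close> are increasing, because translations preserve the order;
  so positive association of the conditional law gives
  \<open>E[f (X + Y) g (X + Y) | X = x] \<ge> F x * G x\<close> for almost every \<open>x\<close>. Integrating over \<open>x\<close>,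
  \<open>E[f (X + Y) g (X + Y)] \<ge> E[F X * G X]\<close>. As \<open>F\<close> and \<open>G\<close> are increasing, positive association
  of the law of \<open>X\<close> bounds the right-hand side below by
  \<open>E[F X] * E[G X] = E[f (X + Y)] * E[g (X + Y)]\<close>.

  Three points make this rigorous. The conditional expectation must be the integral against the
  kernel \<open>K\<close>; this rests on the disintegration of the joint law of \<open>X\<close> and \<open>Y\<close>
  (\<open>joint_law_disintegration\<close>) and the almost sure uniqueness of conditional expectations
  (\<open>cond_exp_eq_kernel_integral\<close>). The functions \<open>F\<close> and \<open>G\<close> are increasing only off a null set,
  whereas positive association speaks of functions that are increasing everywhere; a bounded function
  of the former kind agrees almost everywhere with one of the latter kind
  (\<open>increasing_ae_extension\<close>). That extension is measurable only for the completed measure, which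
  is the notion of measurability for elements of \<open>L\<^sup>2\<close> used here. Finally, square-integrable functions
  are reduced to bounded ones by truncation, which preserves monotonicity
  (\<open>positively_associatedI_bounded\<close>).
\<close>

section \<open>Measurability for completed measures\<close>

lemma borel_measurable_completionI_AE:
  assumes f: "f \<in> borel_measurable M" and eq: "AE x in M. f x = g x"
  shows "g \<in> borel_measurable (completion M)"
proof (rule measurableI)
  fix A :: "'b set" assume A: "A \<in> sets borel"
  show "g -` A \<inter> space (completion M) \<in> sets (completion M)"
  proof (rule completion.in_sets_AE)
    show "AE x in completion M. x \<in> f -` A \<inter> space M \<longleftrightarrow> x \<in> g -` A \<inter> space (completion M)"
      using AE_completion[OF eq] by eventually_elim simp
    show "f -` A \<inter> space M \<in> sets (completion M)"
      using measurable_sets[OF f A] by simp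
  qed simp
qed simp

section \<open>Disintegration of the joint law\<close>

text \<open>The defining property of \<open>E[Z | X]\<close>, written with test functions of the form
  \<open>indicator A (X \<omega>)\<close>, so that later arguments deal with the law of \<open>X\<close> only and not with the
  \<open>\<sigma>\<close>-algebra that \<open>X\<close> generates.\<close>

lemma cond_exp_given_test:
  fixes X :: "'w \<Rightarrow> 'a::topological_space" and Z :: "'w \<Rightarrow> real"
  assumes M: "prob_space M" and X: "X \<in> M \<rightarrow>\<^sub>M borel"
    and Z: "integrable M Z" and h: "cond_exp_given M X Z h"
    and A: "A \<in> sets borel"
  shows "(\<integral>\<omega>. indicator A (X \<omega>) * Z \<omega> \<partial>M) = (\<integral>\<omega>. indicator A (X \<omega>) * h (X \<omega>) \<partial>M)"
    and "integrable M (\<lambda>\<omega>. h (X \<omega>))"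
proof -
  interpret prob_space M by (rule M)
  note [measurable] = X A
  let ?F = "vimage_algebra (space M) X borel"
  have sub: "subalgebra M ?F"
    using X by (auto simp: subalgebra_def sets_vimage_algebra2 intro: measurable_sets)
  interpret finite_measure_subalgebra M ?F
    by unfold_locales (rule sub)
  have XF: "X \<in> ?F \<rightarrow>\<^sub>M borel"
    by (rule measurable_vimage_algebra1) simp
  have [measurable]: "h \<in> borel_measurable borel"
    and ae: "AE \<omega> in M. real_cond_exp M ?F Z \<omega> = h (X \<omega>)"
    using h by (auto simp: cond_exp_given_def)
  have ind: "(\<lambda>\<omega>. indicator A (X \<omega>) :: real) \<in> borel_measurable ?F"
    using XF A by measurable
  have "integrable M (\<lambda>\<omega>. indicator (X -` A \<inter> space M) \<omega> *\<^sub>R Z \<omega>)"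
    using Z by (intro integrable_mult_indicator) auto
  then have intg: "integrable M (\<lambda>\<omega>. indicator A (X \<omega>) * Z \<omega>)"
    by (rule Bochner_Integration.integrable_cong[THEN iffD1, rotated 2])
      (auto simp: indicator_def)
  have [measurable]: "Z \<in> borel_measurable M"
    using Z by simp
  have [measurable]: "real_cond_exp M ?F Z \<in> borel_measurable M"
    by (rule borel_measurable_cond_exp2)
  have "(\<integral>\<omega>. indicator A (X \<omega>) * Z \<omega> \<partial>M) = (\<integral>\<omega>. indicator A (X \<omega>) * real_cond_exp M ?F Z \<omega> \<partial>M)"
    by (rule real_cond_exp_intg(2)[OF intg ind, symmetric]) simp
  also have "\<dots> = (\<integral>\<omega>. indicator A (X \<omega>) * h (X \<omega>) \<partial>M)"
    using ae by (intro integral_cong_AE) auto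
  finally show "(\<integral>\<omega>. indicator A (X \<omega>) * Z \<omega> \<partial>M) = (\<integral>\<omega>. indicator A (X \<omega>) * h (X \<omega>) \<partial>M)" .
  show "integrable M (\<lambda>\<omega>. h (X \<omega>))"
    using ae by (intro integrable_cong_AE_imp[OF real_cond_exp_int(1)[OF Z]]) auto
qed

lemma cond_law_kernel:
  assumes "cond_law_given M X Y K"
  shows "K \<in> borel \<rightarrow>\<^sub>M subprob_algebra borel"
    and "prob_space (K x)" and "sets (K x) = sets borel" and "space (K x) = UNIV"
proof -
  have K: "K \<in> borel \<rightarrow>\<^sub>M prob_algebra borel"
    using assms by (simp add: cond_law_given_def)
  then show "K \<in> borel \<rightarrow>\<^sub>M subprob_algebra borel"
    by (rule measurable_prob_algebraD)
  have "K x \<in> space (prob_algebra borel)"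
    using K by (rule measurable_space) simp
  then show "prob_space (K x)" and s: "sets (K x) = sets borel"
    by (auto simp: space_prob_algebra)
  show "space (K x) = UNIV"
    using sets_eq_imp_space_eq[OF s] by simp
qed

text \<open>The conditional law of the pair given \<open>X = x\<close>: it is \<open>K x\<close> carried to the fibre over \<open>x\<close>.\<close>

lemma joint_kernel:
  fixes X :: "'w \<Rightarrow> 'a::topological_space" and Y :: "'w \<Rightarrow> 'b::topological_space"
  assumes K: "cond_law_given M X Y K"
  shows "Pair x \<in> K x \<rightarrow>\<^sub>M borel \<Otimes>\<^sub>M borel"
    and "(\<lambda>x. distr (K x) (borel \<Otimes>\<^sub>M borel) (Pair x)) \<in> borel \<rightarrow>\<^sub>M subprob_algebra (borel \<Otimes>\<^sub>M borel)"
proof -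
  show "Pair x \<in> K x \<rightarrow>\<^sub>M borel \<Otimes>\<^sub>M borel"
    using measurable_Pair1'[of x borel borel]
    by (simp add: cond_law_kernel(3)[OF K] cong: measurable_cong_sets)
  show "(\<lambda>x. distr (K x) (borel \<Otimes>\<^sub>M borel) (Pair x)) \<in> borel \<rightarrow>\<^sub>M subprob_algebra (borel \<Otimes>\<^sub>M borel)"
    by (rule measurable_distr2[OF _ cond_law_kernel(1)[OF K]]) simp
qed

text \<open>Both sides are probability measures on the product, so it suffices to compare them on measurable
  rectangles \<open>A \<times> B\<close>. There the claim says \<open>P (X \<in> A, Y \<in> B) = E[1\<^sub>A (X) * K X B]\<close>, which is the
  defining property of the conditional probability of \<open>Y \<in> B\<close> given \<open>X\<close>.\<close>

lemma joint_law_disintegration: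
  fixes X :: "'w \<Rightarrow> 'a::topological_space" and Y :: "'w \<Rightarrow> 'b::topological_space"
  assumes M: "prob_space M" and X: "X \<in> M \<rightarrow>\<^sub>M borel" and Y: "Y \<in> M \<rightarrow>\<^sub>M borel"
    and K: "cond_law_given M X Y K"
  shows "distr M (borel \<Otimes>\<^sub>M borel) (\<lambda>\<omega>. (X \<omega>, Y \<omega>)) =
    distr M borel X \<bind> (\<lambda>x. distr (K x) (borel \<Otimes>\<^sub>M borel) (Pair x))"
    (is "?L = ?R")
proof -
  interpret prob_space M by (rule M)
  note [measurable] = X Y cond_law_kernel(1)[OF K]
  note [simp] = cond_law_kernel(3,4)[OF K]
  note J = joint_kernel(2)[OF K]
  let ?E = "{a \<times> b |a b. a \<in> sets (borel :: 'a measure) \<and> b \<in> sets (borel :: 'b measure)}"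
  interpret L: prob_space ?L
    by (rule prob_space_distr) simp
  show ?thesis
  proof (rule measure_eqI_generator_eq[OF Int_stable_pair_measure_generator[of borel borel], where A="\<lambda>_. UNIV"])
    show "?E \<subseteq> Pow UNIV" by simp
    show "sets ?L = sigma_sets UNIV ?E"
      by (simp add: sets_pair_measure)
    have "sets ?R = sets (borel \<Otimes>\<^sub>M borel)"
      by (rule sets_bind) auto
    then show "sets ?R = sigma_sets UNIV ?E"
      by (simp add: sets_pair_measure)
    show "range (\<lambda>_. UNIV :: ('a \<times> 'b) set) \<subseteq> ?E"
      by (auto simp: UNIV_Times_UNIV[symmetric] simp del: UNIV_Times_UNIV intro!: exI[of _ UNIV])
    show "emeasure ?L UNIV \<noteq> \<infinity>"
      using L.emeasure_finite by simp
  next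
    fix E assume "E \<in> ?E"
    then obtain A B where E: "E = A \<times> B"
      and A[measurable]: "A \<in> sets borel" and B[measurable]: "B \<in> sets borel" by auto
    interpret Kx: prob_space "K x" for x by (rule cond_law_kernel(2)[OF K])
    have c: "cond_exp_given M X (\<lambda>\<omega>. indicator B (Y \<omega>)) (\<lambda>x. measure (K x) B)"
      using K B by (simp add: cond_law_given_def)
    have i1: "integrable M (\<lambda>\<omega>. indicator B (Y \<omega>) :: real)"
      by (rule integrable_const_bound[of _ 1]) auto
    have mK[measurable]: "(\<lambda>x. measure (K x) B) \<in> borel_measurable borel"
      using c by (simp add: cond_exp_given_def)
    have i2: "integrable M (\<lambda>\<omega>. indicator A (X \<omega>) * measure (K (X \<omega>)) B)"
      by (rule integrable_const_bound[of _ 1]) (auto simp: indicator_def)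
    have "emeasure ?L E = ennreal (measure ?L E)"
      by (rule L.emeasure_eq_measure)
    also have "measure ?L E = (\<integral>\<omega>. indicator ((\<lambda>\<omega>. (X \<omega>, Y \<omega>)) -` E \<inter> space M) \<omega> \<partial>M)"
      by (simp add: measure_distr E)
    also have "\<dots> = (\<integral>\<omega>. indicator A (X \<omega>) * indicator B (Y \<omega>) \<partial>M)"
      by (rule Bochner_Integration.integral_cong) (auto simp: E indicator_def)
    also have "\<dots> = (\<integral>\<omega>. indicator A (X \<omega>) * measure (K (X \<omega>)) B \<partial>M)"
      by (rule cond_exp_given_test(1)[OF M X i1 c A])
    also have "ennreal \<dots> = (\<integral>\<^sup>+\<omega>. ennreal (indicator A (X \<omega>) * measure (K (X \<omega>)) B) \<partial>M)"
      by (rule nn_integral_eq_integral[symmetric, OF i2]) simp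
    also have "\<dots> = (\<integral>\<^sup>+x. ennreal (indicator A x * measure (K x) B) \<partial>distr M borel X)"
      by (subst nn_integral_distr) auto
    also have "\<dots> = (\<integral>\<^sup>+x. emeasure (distr (K x) (borel \<Otimes>\<^sub>M borel) (Pair x)) E \<partial>distr M borel X)"
    proof (rule nn_integral_cong)
      fix x
      have "Pair x \<in> K x \<rightarrow>\<^sub>M borel \<Otimes>\<^sub>M borel"
        by (rule joint_kernel(1)[OF K])
      moreover have "Pair x -` (A \<times> B) = (if x \<in> A then B else {})" by auto
      ultimately show "ennreal (indicator A x * measure (K x) B) =
          emeasure (distr (K x) (borel \<Otimes>\<^sub>M borel) (Pair x)) E"
        by (simp add: E emeasure_distr Kx.emeasure_eq_measure)
    qed
    also have "\<dots> = emeasure ?R E"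
      using J by (intro emeasure_bind[symmetric]) (auto simp: E cong: measurable_cong_sets)
    finally show "emeasure ?L E = emeasure ?R E" .
  qed auto
qed

lemma AE_joint_iff:
  fixes X :: "'w \<Rightarrow> 'a::topological_space" and Y :: "'w \<Rightarrow> 'b::topological_space"
  assumes M: "prob_space M" and X: "X \<in> M \<rightarrow>\<^sub>M borel" and Y: "Y \<in> M \<rightarrow>\<^sub>M borel"
    and K: "cond_law_given M X Y K"
    and P: "Measurable.pred (borel \<Otimes>\<^sub>M borel) (\<lambda>(x, y). P x y)"
  shows "(AE \<omega> in M. P (X \<omega>) (Y \<omega>)) \<longleftrightarrow> (AE x in distr M borel X. AE y in K x. P x y)"
proof -
  note [measurable] = X Y cond_law_kernel(1)[OF K] P
  note [simp] = cond_law_kernel(3,4)[OF K]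
  note J = joint_kernel(2)[OF K] and pair = joint_kernel(1)[OF K]
  have P': "{z \<in> space (borel \<Otimes>\<^sub>M borel). case_prod P z} \<in> sets (borel \<Otimes>\<^sub>M borel)"
    using P by (simp add: pred_def)
  have "(AE \<omega> in M. P (X \<omega>) (Y \<omega>)) \<longleftrightarrow>
      (AE z in distr M (borel \<Otimes>\<^sub>M borel) (\<lambda>\<omega>. (X \<omega>, Y \<omega>)). case_prod P z)"
    by (subst AE_distr_iff[OF _ P']) auto
  also have "\<dots> \<longleftrightarrow> (AE x in distr M borel X.
      AE z in distr (K x) (borel \<Otimes>\<^sub>M borel) (Pair x). case_prod P z)"
    unfolding joint_law_disintegration[OF M X Y K]
    by (rule AE_bind[OF _ P]) (use J in \<open>simp cong: measurable_cong_sets\<close>)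
  also have "\<dots> \<longleftrightarrow> (AE x in distr M borel X. AE y in K x. P x y)"
    by (subst AE_distr_iff[OF pair P']) simp
  finally show ?thesis .
qed

lemma
  fixes X :: "'w \<Rightarrow> 'a::topological_space" and Y :: "'w \<Rightarrow> 'b::topological_space"
    and \<phi> :: "'a \<Rightarrow> 'b \<Rightarrow> real"
  assumes M: "prob_space M" and X: "X \<in> M \<rightarrow>\<^sub>M borel" and Y: "Y \<in> M \<rightarrow>\<^sub>M borel"
    and K: "cond_law_given M X Y K"
    and \<phi>: "(\<lambda>(x, y). \<phi> x y) \<in> borel_measurable (borel \<Otimes>\<^sub>M borel)"
    and bound: "\<And>x y. \<bar>\<phi> x y\<bar> \<le> C"
  shows integral_joint: "(\<integral>\<omega>. \<phi> (X \<omega>) (Y \<omega>) \<partial>M) = (\<integral>x. (\<integral>y. \<phi> x y \<partial>K x) \<partial>distr M borel X)"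
    and borel_measurable_kernel_integral: "(\<lambda>x. \<integral>y. \<phi> x y \<partial>K x) \<in> borel_measurable borel"
    and kernel_integral_bound: "\<bar>\<integral>y. \<phi> x y \<partial>K x\<bar> \<le> C"
proof -
  note [measurable] = X Y cond_law_kernel(1)[OF K] \<phi>
  note [simp] = cond_law_kernel(3,4)[OF K]
  note J = joint_kernel(2)[OF K] and pair = joint_kernel(1)[OF K]
  have inner: "(\<integral>z. case_prod \<phi> z \<partial>distr (K x) (borel \<Otimes>\<^sub>M borel) (Pair x)) = (\<integral>y. \<phi> x y \<partial>K x)" for x
    by (subst integral_distr[OF pair \<phi>]) simp
  interpret X: prob_space "distr M borel X"
    using prob_space.prob_space_distr[OF M X] .
  interpret Kx: prob_space "K x" for x by (rule cond_law_kernel(2)[OF K])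
  have Jp: "prob_space (distr (K x) (borel \<Otimes>\<^sub>M borel) (Pair x))" for x
    by (rule Kx.prob_space_distr[OF pair])
  have "(\<integral>\<omega>. \<phi> (X \<omega>) (Y \<omega>) \<partial>M) =
      (\<integral>z. case_prod \<phi> z \<partial>distr M (borel \<Otimes>\<^sub>M borel) (\<lambda>\<omega>. (X \<omega>, Y \<omega>)))"
    by (subst integral_distr) auto
  also have "\<dots> = (\<integral>x. (\<integral>z. case_prod \<phi> z \<partial>distr (K x) (borel \<Otimes>\<^sub>M borel) (Pair x)) \<partial>distr M borel X)"
    unfolding joint_law_disintegration[OF M X Y K]
  proof (rule integral_bind[OF \<phi>, where B=C and B'=1])
    show "finite_measure (distr M borel X)" by unfold_locales
    show "AE x in distr M borel X. emeasure (distr (K x) (borel \<Otimes>\<^sub>M borel) (Pair x))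
        (space (distr (K x) (borel \<Otimes>\<^sub>M borel) (Pair x))) \<le> ennreal 1"
      using prob_space.emeasure_space_1[OF Jp] by simp
  qed (use J bound in \<open>auto cong: measurable_cong_sets\<close>)
  finally show "(\<integral>\<omega>. \<phi> (X \<omega>) (Y \<omega>) \<partial>M) = (\<integral>x. (\<integral>y. \<phi> x y \<partial>K x) \<partial>distr M borel X)"
    by (simp only: inner)
  show "(\<lambda>x. \<integral>y. \<phi> x y \<partial>K x) \<in> borel_measurable borel"
    using measurable_compose[OF J integral_measurable_subprob_algebra[OF \<phi>]]
    by (simp only: inner)
  have "\<phi> x \<in> borel_measurable (K x)"
    using measurable_compose[OF pair \<phi>] by simp
  then have "integrable (K x) (\<phi> x)"
    using bound by (intro Kx.integrable_const_bound[of _ C]) auto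
  then have "(\<integral>y. \<bar>\<phi> x y\<bar> \<partial>K x) \<le> (\<integral>y. C \<partial>K x)"
    using bound by (intro integral_mono) auto
  then have "\<bar>\<integral>y. \<phi> x y \<partial>K x\<bar> \<le> (\<integral>y. C \<partial>K x)"
    by (rule order_trans[OF integral_abs_bound])
  then show "\<bar>\<integral>y. \<phi> x y \<partial>K x\<bar> \<le> C"
    using Kx.prob_space[of x] by simp
qed

text \<open>Two integrable functions with the same integral over every Borel set agree almost everywhere. Over
  \<open>A\<close>, the integral of \<open>h\<close> is \<open>E[1\<^sub>A (X) * Z]\<close> by definition of the conditional expectation, and the
  integral of the kernel average is \<open>E[1\<^sub>A (X) * \<phi> (X, Y)]\<close> by disintegration. The variable \<open>Z\<close> is only
  assumed measurable for the completion, because an increasing function of \<open>X + Y\<close> need not be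
  Borel.\<close>

lemma cond_exp_eq_kernel_integral:
  fixes X :: "'w \<Rightarrow> 'a::topological_space" and Y :: "'w \<Rightarrow> 'b::topological_space"
    and \<phi> :: "'a \<Rightarrow> 'b \<Rightarrow> real"
  assumes M: "prob_space M" and X: "X \<in> M \<rightarrow>\<^sub>M borel" and Y: "Y \<in> M \<rightarrow>\<^sub>M borel"
    and K: "cond_law_given M X Y K"
    and \<phi>: "(\<lambda>(x, y). \<phi> x y) \<in> borel_measurable (borel \<Otimes>\<^sub>M borel)"
    and bound: "\<And>x y. \<bar>\<phi> x y\<bar> \<le> C"
    and Z: "Z \<in> borel_measurable (completion M)" and Z_eq: "AE \<omega> in M. Z \<omega> = \<phi> (X \<omega>) (Y \<omega>)"
    and h: "cond_exp_given (completion M) X Z h"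
  shows "AE x in distr M borel X. h x = (\<integral>y. \<phi> x y \<partial>K x)"
proof -
  interpret prob_space M by (rule M)
  interpret C: prob_space "completion M"
    by (rule prob_spaceI) (simp add: emeasure_space_1)
  interpret X: prob_space "distr M borel X"
    by (rule prob_space_distr) (rule X)
  note [measurable] = X Y \<phi> Z
  have XC[measurable]: "X \<in> completion M \<rightarrow>\<^sub>M borel"
    by (rule measurable_completion) (rule X)
  have [measurable]: "(\<lambda>\<omega>. \<phi> (X \<omega>) (Y \<omega>)) \<in> borel_measurable M"
    using measurable_compose[OF _ \<phi>, of "\<lambda>\<omega>. (X \<omega>, Y \<omega>)" M] by simp
  have [measurable]: "(\<lambda>\<omega>. \<phi> (X \<omega>) (Y \<omega>)) \<in> borel_measurable (completion M)"
    by (rule measurable_completion) simp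
  have [measurable]: "h \<in> borel_measurable borel"
    using h by (simp add: cond_exp_given_def)
  note F[measurable] = borel_measurable_kernel_integral[OF M X Y K \<phi> bound]
  have Z_eq': "AE \<omega> in completion M. Z \<omega> = \<phi> (X \<omega>) (Y \<omega>)"
    using Z_eq by (rule AE_completion)
  have intZ: "integrable (completion M) Z"
    by (rule C.integrable_const_bound[of _ C]) (use Z_eq' bound in auto)
  have "integrable M (\<lambda>\<omega>. h (X \<omega>))"
    using cond_exp_given_test(2)[OF C.prob_space_axioms XC intZ h, of UNIV]
    by (subst integrable_completion[symmetric]) auto
  then have int_h: "integrable (distr M borel X) h"
    by (subst integrable_distr_eq) auto
  have int_F: "integrable (distr M borel X) (\<lambda>x. \<integral>y. \<phi> x y \<partial>K x)"
    using kernel_integral_bound[OF M X Y K \<phi> bound]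
    by (intro X.integrable_const_bound[of _ C]) auto
  show ?thesis
  proof (rule density_unique_real[OF int_h int_F])
    fix A assume "A \<in> sets (distr M borel X)"
    then have A[measurable]: "A \<in> sets borel" by simp
    have [measurable]: "(\<lambda>(x, y). indicator A x * \<phi> x y) \<in> borel_measurable (borel \<Otimes>\<^sub>M borel)"
    proof -
      have "(\<lambda>z. indicator A (fst z) * case_prod \<phi> z) \<in> borel_measurable (borel \<Otimes>\<^sub>M borel)"
        by measurable
      then show ?thesis by (simp add: case_prod_beta')
    qed
    have b: "\<bar>indicator A x * \<phi> x y\<bar> \<le> C" for x y
      using bound[of x y] by (auto simp: indicator_def)
    have "(\<integral>x\<in>A. h x \<partial>distr M borel X) = (\<integral>\<omega>. indicator A (X \<omega>) * h (X \<omega>) \<partial>M)"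
      unfolding set_lebesgue_integral_def by (subst integral_distr) auto
    also have "\<dots> = (\<integral>\<omega>. indicator A (X \<omega>) * h (X \<omega>) \<partial>completion M)"
      by (rule integral_completion[symmetric]) simp
    also have "\<dots> = (\<integral>\<omega>. indicator A (X \<omega>) * Z \<omega> \<partial>completion M)"
      by (rule cond_exp_given_test(1)[OF C.prob_space_axioms XC intZ h A, symmetric])
    also have "\<dots> = (\<integral>\<omega>. indicator A (X \<omega>) * \<phi> (X \<omega>) (Y \<omega>) \<partial>completion M)"
      using Z_eq' by (intro integral_cong_AE) auto
    also have "\<dots> = (\<integral>\<omega>. indicator A (X \<omega>) * \<phi> (X \<omega>) (Y \<omega>) \<partial>M)"
      by (rule integral_completion) simp
    also have "\<dots> = (\<integral>x. (\<integral>y. indicator A x * \<phi> x y \<partial>K x) \<partial>distr M borel X)"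
      by (rule integral_joint[OF M X Y K _ b]) simp
    also have "\<dots> = (\<integral>x\<in>A. (\<integral>y. \<phi> x y \<partial>K x) \<partial>distr M borel X)"
      unfolding set_lebesgue_integral_def by simp
    finally show "(\<integral>x\<in>A. h x \<partial>distr M borel X) = (\<integral>x\<in>A. (\<integral>y. \<phi> x y \<partial>K x) \<partial>distr M borel X)" .
  qed
qed

section \<open>Functions increasing off a null set\<close>

text \<open>Let \<open>G\<close> be the set of full measure on which \<open>h\<close> is increasing and bounded by \<open>C\<close>. The extension
  sends \<open>x\<close> to the supremum of \<open>h\<close> over the points of \<open>G\<close> below \<open>x\<close>: it is increasing because that set
  of points grows with \<open>x\<close>, and on \<open>G\<close> the supremum is attained at \<open>x\<close> itself.\<close>

lemma increasing_ae_extension: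
  fixes P :: "'a::order measure" and h :: "'a \<Rightarrow> real"
  assumes incr: "increasing_ae P h" and bound: "AE x in P. \<bar>h x\<bar> \<le> C" and "0 \<le> C"
  obtains h' where "mono h'" "\<And>x. \<bar>h' x\<bar> \<le> C" "AE x in P. h' x = h x"
proof -
  obtain N1 where N1: "N1 \<in> null_sets P"
    and mono: "\<And>u v. u \<notin> N1 \<Longrightarrow> v \<notin> N1 \<Longrightarrow> u \<le> v \<Longrightarrow> h u \<le> h v"
    using incr by (auto simp: increasing_ae_def)
  define G where "G = {x. x \<notin> N1 \<and> \<bar>h x\<bar> \<le> C}"
  \<comment> \<open>Adding \<open>- C\<close> keeps the supremum meaningful when no point of \<open>G\<close> lies below \<open>x\<close>, and does not
     change it otherwise.\<close>
  define S where "S x = insert (- C) (h ` {u \<in> G. u \<le> x})" for x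
  define h' where "h' x = Sup (S x)" for x
  have S: "- C \<in> S x" "\<And>y. y \<in> S x \<Longrightarrow> \<bar>y\<bar> \<le> C" for x
    using \<open>0 \<le> C\<close> by (auto simp: S_def G_def)
  have bdd: "bdd_above (S x)" for x
    using S(2) by (intro bdd_aboveI[of _ C]) (auto simp: abs_le_iff)
  have "mono h'"
  proof
    fix x y :: 'a assume "x \<le> y"
    then have "S x \<subseteq> S y" by (auto simp: S_def)
    then show "h' x \<le> h' y"
      unfolding h'_def using S(1) bdd by (intro cSup_subset_mono) auto
  qed
  moreover have "\<bar>h' x\<bar> \<le> C" for x
  proof -
    have "- C \<le> h' x" unfolding h'_def by (rule cSup_upper[OF S(1) bdd])
    moreover have "h' x \<le> C"
      unfolding h'_def using S by (intro cSup_least) (auto simp: abs_le_iff)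
    ultimately show ?thesis by auto
  qed
  moreover have "h' x = h x" if "x \<in> G" for x
    unfolding h'_def
  proof (rule cSup_eq_maximum)
    show "h x \<in> S x" using that by (auto simp: S_def)
    show "y \<le> h x" if "y \<in> S x" for y
      using that \<open>x \<in> G\<close> mono by (auto simp: S_def G_def)
  qed
  moreover have "AE x in P. x \<in> G"
    using AE_not_in[OF N1] bound by eventually_elim (auto simp: G_def)
  ultimately show ?thesis
    by (intro that[of h']) auto
qed

lemma in_L2_bounded:
  assumes "prob_space P" "f \<in> borel_measurable (completion P)" "\<And>x. \<bar>f x\<bar> \<le> C"
  shows "in_L2 P f"
proof -
  interpret C: prob_space "completion P"
    using prob_space.emeasure_space_1[OF assms(1)] by (intro prob_spaceI) simp
  have "\<bar>(f x)\<^sup>2\<bar> \<le> C\<^sup>2" for x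
    using power_mono[OF assms(3)[of x] abs_ge_zero, of 2] by simp
  then have "integrable (completion P) (\<lambda>x. (f x)\<^sup>2)"
    using assms(2) by (intro C.integrable_const_bound[of _ "C\<^sup>2"]) auto
  with assms(2) show ?thesis by (simp add: in_L2_def)
qed

text \<open>Positive association does not see null sets: replace \<open>h\<close> and \<open>k\<close> by their increasing extensions,
  which have the same integrals.\<close>

lemma positively_associated_increasing_ae:
  fixes P :: "'a::order measure" and h k :: "'a \<Rightarrow> real"
  assumes P: "positively_associated P"
    and h: "h \<in> borel_measurable P" "increasing_ae P h" "AE x in P. \<bar>h x\<bar> \<le> C"
    and k: "k \<in> borel_measurable P" "increasing_ae P k" "AE x in P. \<bar>k x\<bar> \<le> C"
    and "0 \<le> C"
  shows "(\<integral>x. h x \<partial>P) * (\<integral>x. k x \<partial>P) \<le> (\<integral>x. h x * k x \<partial>P)"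
proof -
  have prob: "prob_space P" using P by (simp add: positively_associated_def)
  obtain h' where h': "mono h'" "\<And>x. \<bar>h' x\<bar> \<le> C" "AE x in P. h' x = h x"
    using increasing_ae_extension[OF h(2,3) \<open>0 \<le> C\<close>] by blast
  obtain k' where k': "mono k'" "\<And>x. \<bar>k' x\<bar> \<le> C" "AE x in P. k' x = k x"
    using increasing_ae_extension[OF k(2,3) \<open>0 \<le> C\<close>] by blast
  note [measurable] = h(1) k(1)
  have [measurable]: "h \<in> borel_measurable (completion P)" "k \<in> borel_measurable (completion P)"
    by (auto intro: measurable_completion)
  have ae: "AE x in completion P. h x = h' x" "AE x in completion P. k x = k' x"
    using h'(3) k'(3) by (auto intro!: AE_completion)
  have [measurable]: "h' \<in> borel_measurable (completion P)"
    using h(1) by (rule borel_measurable_completionI_AE) (use h'(3) in auto)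
  have [measurable]: "k' \<in> borel_measurable (completion P)"
    using k(1) by (rule borel_measurable_completionI_AE) (use k'(3) in auto)
  have "in_L2 P h'" "in_L2 P k'"
    by (rule in_L2_bounded[OF prob _ h'(2)] in_L2_bounded[OF prob _ k'(2)], simp)+
  then have "(\<integral>x. h' x \<partial>completion P) * (\<integral>x. k' x \<partial>completion P) \<le> (\<integral>x. h' x * k' x \<partial>completion P)"
    using P h'(1) k'(1) by (auto simp: positively_associated_def)
  moreover have "(\<integral>x. h' x \<partial>completion P) = (\<integral>x. h x \<partial>completion P)"
    using ae by (intro integral_cong_AE) auto
  moreover have "(\<integral>x. k' x \<partial>completion P) = (\<integral>x. k x \<partial>completion P)"
    using ae by (intro integral_cong_AE) auto
  moreover have "(\<integral>x. h' x * k' x \<partial>completion P) = (\<integral>x. h x * k x \<partial>completion P)"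
    using ae by (intro integral_cong_AE) auto
  ultimately show ?thesis
    by (simp add: integral_completion)
qed

text \<open>The inequality inside the fibre over \<open>x\<close>. The functions \<open>f\<close> and \<open>g\<close> carry the monotonicity, while
  \<open>f0\<close> and \<open>g0\<close> stand for measurable versions of them, against which the kernel can be integrated
  measurably in \<open>x\<close>.\<close>

lemma positively_associated_translate:
  fixes Q :: "'e::pogroup measure" and f g f0 g0 :: "'e \<Rightarrow> real"
  assumes Q: "positively_associated Q"
    and f: "mono f" "\<And>z. \<bar>f z\<bar> \<le> C" "AE y in Q. f (x + y) = f0 (x + y)"
    and g: "mono g" "\<And>z. \<bar>g z\<bar> \<le> C" "AE y in Q. g (x + y) = g0 (x + y)"
    and f0: "(\<lambda>y. f0 (x + y)) \<in> borel_measurable Q"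
    and g0: "(\<lambda>y. g0 (x + y)) \<in> borel_measurable Q"
  shows "(\<integral>y. f0 (x + y) \<partial>Q) * (\<integral>y. g0 (x + y) \<partial>Q) \<le> (\<integral>y. f0 (x + y) * g0 (x + y) \<partial>Q)"
proof -
  have prob: "prob_space Q" using Q by (simp add: positively_associated_def)
  note [measurable] = f0 g0
  have [measurable]: "(\<lambda>y. f0 (x + y)) \<in> borel_measurable (completion Q)"
    "(\<lambda>y. g0 (x + y)) \<in> borel_measurable (completion Q)"
    by (auto intro: measurable_completion)
  have ae: "AE y in completion Q. f0 (x + y) = f (x + y)" "AE y in completion Q. g0 (x + y) = g (x + y)"
    using f(3) g(3) by (auto intro!: AE_completion)
  have m[measurable]: "(\<lambda>y. f (x + y)) \<in> borel_measurable (completion Q)"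
    "(\<lambda>y. g (x + y)) \<in> borel_measurable (completion Q)"
    by (rule borel_measurable_completionI_AE[OF f0] borel_measurable_completionI_AE[OF g0],
        use f(3) g(3) in auto)+
  have "mono (\<lambda>y. f (x + y))" "mono (\<lambda>y. g (x + y))"
    by (auto intro!: monoI monoD[OF f(1)] monoD[OF g(1)] add_left_mono)
  moreover have "in_L2 Q (\<lambda>y. f (x + y))" "in_L2 Q (\<lambda>y. g (x + y))"
    by (rule in_L2_bounded[OF prob m(1) f(2)] in_L2_bounded[OF prob m(2) g(2)])+
  ultimately have "(\<integral>y. f (x + y) \<partial>completion Q) * (\<integral>y. g (x + y) \<partial>completion Q)
      \<le> (\<integral>y. f (x + y) * g (x + y) \<partial>completion Q)"
    using Q unfolding positively_associated_def by blast
  moreover have "(\<integral>y. f (x + y) \<partial>completion Q) = (\<integral>y. f0 (x + y) \<partial>completion Q)"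
    using ae by (intro integral_cong_AE) auto
  moreover have "(\<integral>y. g (x + y) \<partial>completion Q) = (\<integral>y. g0 (x + y) \<partial>completion Q)"
    using ae by (intro integral_cong_AE) auto
  moreover have "(\<integral>y. f (x + y) * g (x + y) \<partial>completion Q) = (\<integral>y. f0 (x + y) * g0 (x + y) \<partial>completion Q)"
    using ae by (intro integral_cong_AE) auto
  ultimately show ?thesis
    by (simp add: integral_completion)
qed

section \<open>Reduction to bounded functions\<close>

definition truncate :: "real \<Rightarrow> real \<Rightarrow> real" where
  "truncate c t = max (- c) (min c t)"

lemma truncate_simps:
  "0 \<le> c \<Longrightarrow> \<bar>truncate c t\<bar> \<le> c" "0 \<le> c \<Longrightarrow> \<bar>truncate c t\<bar> \<le> \<bar>t\<bar>" "\<bar>t\<bar> \<le> c \<Longrightarrow> truncate c t = t"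
  "s \<le> t \<Longrightarrow> truncate c s \<le> truncate c t"
  by (auto simp: truncate_def)

lemma borel_measurable_truncate[measurable]: "truncate c \<in> borel_measurable borel"
  unfolding truncate_def by measurable

lemma truncate_tendsto: "(\<lambda>n. truncate (real n) t) \<longlonglongrightarrow> t"
proof (rule tendsto_eventually)
  show "\<forall>\<^sub>F n in sequentially. truncate (real n) t = t"
    using eventually_ge_at_top[of "nat \<lceil>\<bar>t\<bar>\<rceil>"]
    by eventually_elim (auto intro!: truncate_simps(3) simp: le_nat_iff ceiling_le_iff)
qed

text \<open>Truncating at levels \<open>-n\<close> and \<open>n\<close> keeps \<open>f\<close> and \<open>g\<close> increasing. On both sides of the inequality one
  may let \<open>n\<close> tend to infinity by dominated convergence, since \<open>f\<close>, \<open>g\<close> and \<open>f * g\<close> are integrable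
  when \<open>f\<close> and \<open>g\<close> are square-integrable.\<close>

lemma positively_associatedI_bounded:
  fixes P :: "'a::order measure"
  assumes P: "prob_space P"
    and bounded: "\<And>(f :: 'a \<Rightarrow> real) (g :: 'a \<Rightarrow> real) C. mono f \<Longrightarrow> mono g \<Longrightarrow> (\<And>z. \<bar>f z\<bar> \<le> C) \<Longrightarrow> (\<And>z. \<bar>g z\<bar> \<le> C) \<Longrightarrow>
      f \<in> borel_measurable (completion P) \<Longrightarrow> g \<in> borel_measurable (completion P) \<Longrightarrow>
      (\<integral>z. f z \<partial>completion P) * (\<integral>z. g z \<partial>completion P) \<le> (\<integral>z. f z * g z \<partial>completion P)"
  shows "positively_associated P"
  unfolding positively_associated_def
proof (intro conjI allI impI P)
  interpret C: prob_space "completion P"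
    using prob_space.emeasure_space_1[OF P] by (intro prob_spaceI) simp
  fix f g :: "'a \<Rightarrow> real"
  assume "mono f \<and> mono g \<and> in_L2 P f \<and> in_L2 P g"
  then have mono: "mono f" "mono g"
    and [measurable]: "f \<in> borel_measurable (completion P)" "g \<in> borel_measurable (completion P)"
    and sq: "integrable (completion P) (\<lambda>z. (f z)\<^sup>2)" "integrable (completion P) (\<lambda>z. (g z)\<^sup>2)"
    by (auto simp: in_L2_def)
  have f: "integrable (completion P) f" and g: "integrable (completion P) g"
    using sq by (auto intro: C.square_integrable_imp_integrable)
  have fg: "integrable (completion P) (\<lambda>z. \<bar>f z\<bar> * \<bar>g z\<bar>)"
  proof (rule Bochner_Integration.integrable_bound[OF Bochner_Integration.integrable_add[OF sq]])
    show "AE z in completion P. norm (\<bar>f z\<bar> * \<bar>g z\<bar>) \<le> norm ((f z)\<^sup>2 + (g z)\<^sup>2)"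
    proof (rule AE_I2)
      fix z
      have "2 * \<bar>f z\<bar> * \<bar>g z\<bar> \<le> (f z)\<^sup>2 + (g z)\<^sup>2"
        using sum_squares_bound[of "\<bar>f z\<bar>" "\<bar>g z\<bar>"] by simp
      moreover have "0 \<le> \<bar>f z\<bar> * \<bar>g z\<bar>" by simp
      ultimately have "\<bar>f z\<bar> * \<bar>g z\<bar> \<le> (f z)\<^sup>2 + (g z)\<^sup>2" by linarith
      then show "norm (\<bar>f z\<bar> * \<bar>g z\<bar>) \<le> norm ((f z)\<^sup>2 + (g z)\<^sup>2)" by (simp add: abs_mult)
    qed
  qed simp
  let ?f = "\<lambda>n z. truncate (real n) (f z)" and ?g = "\<lambda>n z. truncate (real n) (g z)"
  have lim_f: "(\<lambda>n. \<integral>z. ?f n z \<partial>completion P) \<longlonglongrightarrow> (\<integral>z. f z \<partial>completion P)"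
    by (rule integral_dominated_convergence[where w="\<lambda>z. \<bar>f z\<bar>"])
      (use f in \<open>auto intro!: AE_I2 truncate_tendsto truncate_simps(2)\<close>)
  have lim_g: "(\<lambda>n. \<integral>z. ?g n z \<partial>completion P) \<longlonglongrightarrow> (\<integral>z. g z \<partial>completion P)"
    by (rule integral_dominated_convergence[where w="\<lambda>z. \<bar>g z\<bar>"])
      (use g in \<open>auto intro!: AE_I2 truncate_tendsto truncate_simps(2)\<close>)
  have lim_fg: "(\<lambda>n. \<integral>z. ?f n z * ?g n z \<partial>completion P) \<longlonglongrightarrow> (\<integral>z. f z * g z \<partial>completion P)"
    by (rule integral_dominated_convergence[where w="\<lambda>z. \<bar>f z\<bar> * \<bar>g z\<bar>"])
      (use fg in \<open>auto intro!: AE_I2 tendsto_mult truncate_tendsto truncate_simps(2) mult_mono simp: abs_mult\<close>)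
  have "(\<integral>z. ?f n z \<partial>completion P) * (\<integral>z. ?g n z \<partial>completion P)
      \<le> (\<integral>z. ?f n z * ?g n z \<partial>completion P)" for n
  proof (rule bounded[where C="real n"])
    show "mono (?f n)" "mono (?g n)"
      using mono by (auto intro!: monoI truncate_simps(4) dest: monoD)
  qed (auto intro: truncate_simps(1))
  then show "(\<integral>z. f z \<partial>completion P) * (\<integral>z. g z \<partial>completion P) \<le> (\<integral>z. f z * g z \<partial>completion P)"
    by (intro LIMSEQ_le[OF tendsto_mult[OF lim_f lim_g] lim_fg]) auto
qed

lemma bounded_Borel_version:
  fixes f :: "'a \<Rightarrow> real"
  assumes "f \<in> borel_measurable (completion P)" and "\<And>z. \<bar>f z\<bar> \<le> C"
  obtains f0 where "f0 \<in> borel_measurable P" "\<And>z. \<bar>f0 z\<bar> \<le> C" "AE z in P. f z = f0 z"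
proof -
  obtain f1 where f1: "f1 \<in> borel_measurable P" "AE z in P. f z = f1 z"
    using completion_ex_borel_measurable_real[OF assms(1)] by auto
  have "0 \<le> C" using assms(2) by (rule order_trans[OF abs_ge_zero])
  show ?thesis
  proof
    show "(\<lambda>z. truncate C (f1 z)) \<in> borel_measurable P"
      using f1(1) by simp
    show "\<bar>truncate C (f1 z)\<bar> \<le> C" for z
      using \<open>0 \<le> C\<close> by (rule truncate_simps(1))
    show "AE z in P. f z = truncate C (f1 z)"
      using f1(2) by eventually_elim (metis assms(2) truncate_simps(3))
  qed
qed

section \<open>Positive association of the sum\<close>

theorem proposition1p4:
  fixes M :: "'w measure"
    and X Y :: "'w \<Rightarrow> 'e::pogroup"
    and K :: "'e \<Rightarrow> 'e measure"
  assumes order_measurable: "{(u, v). u \<le> v} \<in> sets (borel \<Otimes>\<^sub>M (borel :: 'e measure))"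
    and add_measurable: "(\<lambda>(x, y). x + y) \<in> borel \<Otimes>\<^sub>M borel \<rightarrow>\<^sub>M (borel :: 'e measure)"
    and M: "prob_space M"
    and X: "X \<in> M \<rightarrow>\<^sub>M borel"
    and Y: "Y \<in> M \<rightarrow>\<^sub>M borel"
    and K: "cond_law_given M X Y K"
    and law_X: "positively_associated (distr M borel X)"
    and law_Y_given_X: "AE x in distr M borel X. positively_associated (K x)"
    and increasing_cond_exp:
      "\<And>f :: 'e \<Rightarrow> real.
         f \<in> borel_measurable (completion (distr M borel (\<lambda>\<omega>. X \<omega> + Y \<omega>))) \<Longrightarrow>
         bounded (range f) \<Longrightarrow> mono f \<Longrightarrow>
         \<exists>h. cond_exp_given (completion M) X (\<lambda>\<omega>. f (X \<omega> + Y \<omega>)) h \<and>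
             increasing_ae (distr M borel X) h"
  shows "positively_associated (distr M borel (\<lambda>\<omega>. X \<omega> + Y \<omega>))"
proof -
  let ?Z = "\<lambda>\<omega>. X \<omega> + Y \<omega>"
  let ?P = "distr M borel ?Z" and ?PX = "distr M borel X"
  note [measurable] = X Y
  have Z[measurable]: "?Z \<in> M \<rightarrow>\<^sub>M borel"
    using measurable_compose[OF _ add_measurable, of "\<lambda>\<omega>. (X \<omega>, Y \<omega>)" M] by simp
  have prob: "prob_space ?P"
    using prob_space.prob_space_distr[OF M Z] .
  have shift: "(\<lambda>y. x + y) \<in> K x \<rightarrow>\<^sub>M borel" for x
    using measurable_compose[OF measurable_Pair1'[of x borel borel] add_measurable]
    by (simp add: cond_law_kernel(3)[OF K] cong: measurable_cong_sets)
  interpret X: prob_space ?PX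
    by (rule prob_space.prob_space_distr[OF M X])
  \<comment> \<open>Each bounded increasing \<open>f\<close> comes with a Borel version \<open>f0\<close>, which agrees with \<open>f\<close> also in almost
     every fibre, and with an increasing version \<open>h\<close> of its conditional expectation. Almost
     everywhere \<open>h\<close> is the kernel average of \<open>f0\<close>, which ties the monotonicity of \<open>h\<close> to the
     association of the laws \<open>K x\<close>.\<close>
  have version: "\<exists>f0 h. f0 \<in> borel_measurable borel \<and> (\<forall>z. \<bar>f0 z\<bar> \<le> C) \<and> (AE z in ?P. f z = f0 z) \<and>
      (AE x in ?PX. AE y in K x. f (x + y) = f0 (x + y)) \<and>
      h \<in> borel_measurable borel \<and> increasing_ae ?PX h \<and>
      (AE x in ?PX. h x = (\<integral>y. f0 (x + y) \<partial>K x)) \<and> (AE x in ?PX. \<bar>h x\<bar> \<le> C)"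
    if f: "mono f" "\<And>z. \<bar>f z\<bar> \<le> C" "f \<in> borel_measurable (completion ?P)" for f :: "'e \<Rightarrow> real" and C
  proof -
    obtain f0 where f0: "f0 \<in> borel_measurable ?P" "\<And>z. \<bar>f0 z\<bar> \<le> C" "AE z in ?P. f z = f0 z"
      using bounded_Borel_version[OF f(3,2)] by blast
    have f0m[measurable]: "f0 \<in> borel_measurable borel"
      using f0(1) by (simp cong: measurable_cong_sets)
    have \<phi>: "(\<lambda>(x, y). f0 (x + y)) \<in> borel_measurable (borel \<Otimes>\<^sub>M borel)"
      using measurable_compose[OF add_measurable f0m] by (simp add: case_prod_beta')
    obtain N where "\<And>z. z \<in> space ?P - N \<Longrightarrow> f z = f0 z" and N: "N \<in> null_sets ?P"
      using AE_E3[OF f0(3)] by blast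
    then have off_N: "z \<notin> N \<Longrightarrow> f z = f0 z" for z by simp
    have Nm[measurable]: "N \<in> sets borel" using N by auto
    \<comment> \<open>The set where \<open>f\<close> and \<open>f0\<close> differ need not be Borel, so the disintegration is applied to a
       Borel null set \<open>N\<close> containing it.\<close>
    have "AE z in ?P. z \<notin> N" using N by (rule AE_not_in)
    then have N_M: "AE \<omega> in M. X \<omega> + Y \<omega> \<notin> N"
      by (subst (asm) AE_distr_iff) auto
    have predN: "Measurable.pred (borel \<Otimes>\<^sub>M borel) (\<lambda>(x, y). x + y \<notin> N)"
    proof -
      have "Measurable.pred borel (\<lambda>z. z \<notin> N)" by measurable
      from measurable_compose[OF add_measurable this] show ?thesis
        by (simp add: case_prod_beta')
    qed
    have ae_K: "AE x in ?PX. AE y in K x. f (x + y) = f0 (x + y)"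
      using AE_joint_iff[OF M X Y K predN] N_M off_N by (auto elim!: eventually_mono)
    have ae_M: "AE \<omega> in M. f (?Z \<omega>) = f0 (?Z \<omega>)"
      using N_M off_N by (auto elim!: eventually_mono)
    have "(\<lambda>\<omega>. f0 (?Z \<omega>)) \<in> borel_measurable M"
      by measurable
    then have fZ: "(\<lambda>\<omega>. f (?Z \<omega>)) \<in> borel_measurable (completion M)"
      by (rule borel_measurable_completionI_AE) (use ae_M in auto)
    have "bounded (range f)"
      using f(2) by (auto simp: bounded_iff)
    then obtain h where h: "cond_exp_given (completion M) X (\<lambda>\<omega>. f (?Z \<omega>)) h" "increasing_ae ?PX h"
      using increasing_cond_exp[OF f(3) _ f(1)] by auto
    have h_eq: "AE x in ?PX. h x = (\<integral>y. f0 (x + y) \<partial>K x)"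
      by (rule cond_exp_eq_kernel_integral[OF M X Y K \<phi> f0(2) fZ ae_M h(1)])
    have "AE x in ?PX. \<bar>h x\<bar> \<le> C"
      using h_eq by eventually_elim (simp add: kernel_integral_bound[OF M X Y K \<phi> f0(2)])
    with f0 f0m ae_K h h_eq show ?thesis
      by (intro exI[of _ f0] exI[of _ h]) (auto simp: cond_exp_given_def)
  qed
  show ?thesis
  proof (rule positively_associatedI_bounded[OF prob])
    fix f g :: "'e \<Rightarrow> real" and C
    assume f: "mono f" "\<And>z. \<bar>f z\<bar> \<le> C" "f \<in> borel_measurable (completion ?P)"
      and g: "mono g" "\<And>z. \<bar>g z\<bar> \<le> C" "g \<in> borel_measurable (completion ?P)"
    have "0 \<le> C" using f(2) by (rule order_trans[OF abs_ge_zero])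
    obtain f0 h where f0[measurable]: "f0 \<in> borel_measurable borel" and f0_b: "\<And>z. \<bar>f0 z\<bar> \<le> C"
      and f0_P: "AE z in ?P. f z = f0 z" and f0_K: "AE x in ?PX. AE y in K x. f (x + y) = f0 (x + y)"
      and h[measurable]: "h \<in> borel_measurable borel" and h_inc: "increasing_ae ?PX h"
      and h_eq: "AE x in ?PX. h x = (\<integral>y. f0 (x + y) \<partial>K x)" and h_b: "AE x in ?PX. \<bar>h x\<bar> \<le> C"
      using version[OF f] by blast
    obtain g0 k where g0[measurable]: "g0 \<in> borel_measurable borel" and g0_b: "\<And>z. \<bar>g0 z\<bar> \<le> C"
      and g0_P: "AE z in ?P. g z = g0 z" and g0_K: "AE x in ?PX. AE y in K x. g (x + y) = g0 (x + y)"
      and k[measurable]: "k \<in> borel_measurable borel" and k_inc: "increasing_ae ?PX k"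
      and k_eq: "AE x in ?PX. k x = (\<integral>y. g0 (x + y) \<partial>K x)" and k_b: "AE x in ?PX. \<bar>k x\<bar> \<le> C"
      using version[OF g] by blast
    have mean: "(\<integral>z. u z \<partial>completion ?P) = (\<integral>x. (\<integral>y. u0 (x + y) \<partial>K x) \<partial>?PX)"
      "(\<lambda>x. \<integral>y. u0 (x + y) \<partial>K x) \<in> borel_measurable borel"
      "\<bar>\<integral>y. u0 (x + y) \<partial>K x\<bar> \<le> B"
      if "u \<in> borel_measurable (completion ?P)" "u0 \<in> borel_measurable borel"
        "\<And>z. \<bar>u0 z\<bar> \<le> B" "AE z in ?P. u z = u0 z" for u u0 :: "'e \<Rightarrow> real" and B x
    proof -
      have u0: "u0 \<in> borel_measurable ?P"
        using that(2) by (simp cong: measurable_cong_sets)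
      have \<phi>: "(\<lambda>(x, y). u0 (x + y)) \<in> borel_measurable (borel \<Otimes>\<^sub>M borel)"
        using measurable_compose[OF add_measurable that(2)] by (simp add: case_prod_beta')
      have "(\<integral>z. u z \<partial>completion ?P) = (\<integral>z. u0 z \<partial>completion ?P)"
        using that(1,4) measurable_completion[OF u0] by (intro integral_cong_AE AE_completion)
      also have "\<dots> = (\<integral>z. u0 z \<partial>?P)"
        by (rule integral_completion) (rule u0)
      also have "\<dots> = (\<integral>\<omega>. u0 (?Z \<omega>) \<partial>M)"
        using that(2) by (subst integral_distr) auto
      also have "\<dots> = (\<integral>x. (\<integral>y. u0 (x + y) \<partial>K x) \<partial>?PX)"
        by (rule integral_joint[OF M X Y K \<phi> that(3)])
      finally show "(\<integral>z. u z \<partial>completion ?P) = (\<integral>x. (\<integral>y. u0 (x + y) \<partial>K x) \<partial>?PX)" .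
      show "(\<lambda>x. \<integral>y. u0 (x + y) \<partial>K x) \<in> borel_measurable borel"
        by (rule borel_measurable_kernel_integral[OF M X Y K \<phi> that(3)])
      show "\<bar>\<integral>y. u0 (x + y) \<partial>K x\<bar> \<le> B"
        by (rule kernel_integral_bound[OF M X Y K \<phi> that(3)])
    qed
    note F = mean[OF f(3) f0 f0_b f0_P] and G = mean[OF g(3) g0 g0_b g0_P]
    have fg: "(\<lambda>z. f z * g z) \<in> borel_measurable (completion ?P)"
      using f(3) g(3) by simp
    have fg0: "(\<lambda>z. f0 z * g0 z) \<in> borel_measurable borel" by measurable
    have fg0_b: "\<bar>f0 z * g0 z\<bar> \<le> C * C" for z
      unfolding abs_mult using f0_b g0_b \<open>0 \<le> C\<close> by (intro mult_mono) auto
    have fg_P: "AE z in ?P. f z * g z = f0 z * g0 z"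
      using f0_P g0_P by eventually_elim simp
    note FG = mean[OF fg fg0 fg0_b fg_P]
    note [measurable] = F(2) G(2) FG(2)
    have "(\<integral>z. f z \<partial>completion ?P) * (\<integral>z. g z \<partial>completion ?P) = (\<integral>x. h x \<partial>?PX) * (\<integral>x. k x \<partial>?PX)"
      unfolding F(1) G(1) using h_eq k_eq
      by (intro arg_cong2[where f="(*)"] integral_cong_AE) auto
    also have "\<dots> \<le> (\<integral>x. h x * k x \<partial>?PX)"
      using h_inc h_b k_inc k_b \<open>0 \<le> C\<close>
      by (intro positively_associated_increasing_ae[OF law_X, where C=C]) auto
    also have "\<dots> \<le> (\<integral>x. (\<integral>y. f0 (x + y) * g0 (x + y) \<partial>K x) \<partial>?PX)"
    proof (rule integral_mono_AE)
      show "integrable ?PX (\<lambda>x. h x * k x)"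
      proof (rule X.integrable_const_bound[of _ "C * C"])
        show "AE x in ?PX. norm (h x * k x) \<le> C * C"
          using h_b k_b by eventually_elim (auto simp: abs_mult intro!: mult_mono \<open>0 \<le> C\<close>)
      qed simp
      show "integrable ?PX (\<lambda>x. \<integral>y. f0 (x + y) * g0 (x + y) \<partial>K x)"
        using FG(3) by (intro X.integrable_const_bound[of _ "C * C"]) auto
      show "AE x in ?PX. h x * k x \<le> (\<integral>y. f0 (x + y) * g0 (x + y) \<partial>K x)"
        using law_Y_given_X h_eq k_eq f0_K g0_K
      proof eventually_elim
        case (elim x)
        show ?case
          unfolding elim(2,3)
          by (rule positively_associated_translate[OF elim(1) f(1,2) elim(4) g(1,2) elim(5)])
            (rule measurable_compose[OF shift f0] measurable_compose[OF shift g0])+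
      qed
    qed
    also have "\<dots> = (\<integral>z. f z * g z \<partial>completion ?P)"
      by (rule FG(1)[symmetric])
    finally show "(\<integral>z. f z \<partial>completion ?P) * (\<integral>z. g z \<partial>completion ?P)
        \<le> (\<integral>z. f z * g z \<partial>completion ?P)" .
  qed
qed

end
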